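(* Let $A\subset P$ be a pair of finite posets with $\min(P)\cup\max(P)\subseteq A$, and let $\lambda: A\to\mathbb{Z}$ be order preserving. Let $\mathcal{I}$ be the chain of order ideals of $A$ such that $\lambda$ lies in the relative interior of $F(\mathcal{I})$, and let $p_{\mathcal{I}}$ be the polynomial with $\Omega_{P,A}(\mu)=p_{\mathcal{I}}(\mu)$ for all $\mu\in F(\mathcal{I})\cap\mathbb{Z}^A$. Then \[ (-1)^{\dim \mathcal{O}_{P,A}(\lambda)}\,\Omega_{P,A}(-\lambda),\qquad\text{where } \Omega_{P,A}(-\lambda):=p_{\mathcal{I}}(-\lambda), \] equals the number of strict order preserving extensions $\widehat\lambda : P\to\mathbb{Z}$ of $\lambda$.
   Context: A map $\phi$ from a poset to $\mathbb{R}$ is order preserving if $\phi(p)\le\phi(q)$ whenever $p\preceq q$. For order preserving $\lambda:A\to\mathbb{R}$, $\mathcal{O}_{P,A}(\lambda)=\{\phi\in\mathbb{R}^P$ order preserving with $\phi|_A=\lambda\}$ (the marked order polytope) and $\Omega_{P,A}(\lambda)=|\mathcal{O}_{P,A}(\lambda)\cap\mathbb{Z}^P|$ for integral $\lambda$. A chain of order ideals of $A$ is $\emptyset\ne I_0\subsetneq\cdots\subsetneq I_k=A$ with each $I_j$ down-closed; $F(\mathcal{I})\subseteq\mathbb{R}^A$ is the set of $\phi$ constant on each $I_j\setminus I_{j-1}$ ($I_{-1}=\emptyset$) with weakly increasing values $\phi(I_0)\le\phi(I_1\setminus I_0)\le\cdots$; these cones subdivide the cone of order preserving maps $A\to\mathbb{R}$,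 and $\Omega_{P,A}$ agrees with a polynomial $p_{\mathcal{I}}$ on the integral points of each $F(\mathcal{I})$. An extension $\widehat\lambda:P\to\mathbb{Z}$ of $\lambda$ (order preserving, $\widehat\lambda|_A=\lambda$) is strict if whenever $p\prec q$ and $\widehat\lambda(p)=\widehat\lambda(q)$, there are $a,b\in A$ with $\lambda(a)=\lambda(b)$ and $a\preceq p\prec q\preceq b$. *)

theory Defs
  imports "HOL-Analysis.Analysis"
begin

text \<open>
  The finite poset \<open>P\<close> is the universe of a type of classes \<open>finite\<close> and \<open>order\<close>, so that
  \<open>\<real>\<^sup>P\<close> is \<open>real ^ 'p\<close>. The subposet \<open>A\<close> is a set with the induced order. The space \<open>\<real>\<^sup>A\<close> is
  the coordinate subspace of \<open>\<real>\<^sup>P\<close> of vectors vanishing outside \<open>A\<close>; polynomial functions on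
  \<open>\<real>\<^sup>A\<close> are the restrictions of those on \<open>\<real>\<^sup>P\<close>.
\<close>

definition coord_space :: "'p set \<Rightarrow> (real ^ 'p) set" where
  "coord_space A = {x. \<forall>i. i \<notin> A \<longrightarrow> x $ i = 0}"

definition int_points :: "(real ^ 'p) set" where
  "int_points = {x. \<forall>i. x $ i \<in> \<int>}"

text \<open>The values of \<open>l\<close> outside \<open>A\<close> are ignored.\<close>

definition vec_of :: "'p set \<Rightarrow> ('p \<Rightarrow> int) \<Rightarrow> real ^ 'p" where
  "vec_of A l = (\<chi> i. if i \<in> A then of_int (l i) else 0)"

definition minimal_elems :: "'p::order set" where
  "minimal_elems = {p. \<not> (\<exists>q. q < p)}"

definition maximal_elems :: "'p::order set" where
  "maximal_elems = {p. \<not> (\<exists>q. p < q)}"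

definition marked_order_polytope :: "'p::{finite,order} set \<Rightarrow> (real, 'p) vec \<Rightarrow> (real, 'p) vec set" where
  "marked_order_polytope A \<mu> = {\<phi>. mono (\<lambda>p. \<phi> $ p) \<and> (\<forall>a\<in>A. \<phi> $ a = \<mu> $ a)}"

text \<open>
  The set counted here is finite when \<open>A\<close> contains all minimal and maximal elements.
\<close>

definition Omega :: "'p::{finite,order} set \<Rightarrow> (real, 'p) vec \<Rightarrow> nat" where
  "Omega A \<mu> = card (marked_order_polytope A \<mu> \<inter> int_points)"

definition order_ideal :: "'p::order set \<Rightarrow> 'p set \<Rightarrow> bool" where
  "order_ideal A J \<longleftrightarrow> J \<subseteq> A \<and> (\<forall>x\<in>J. \<forall>y\<in>A. y \<le> x \<longrightarrow> y \<in> J)"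

text \<open>The chain \<open>I 0 \<subset> \<dots> \<subset> I k = A\<close>; the values \<open>I j\<close> with \<open>j > k\<close> play no role.\<close>

definition ideal_chain :: "'p::order set \<Rightarrow> nat \<Rightarrow> (nat \<Rightarrow> 'p set) \<Rightarrow> bool" where
  "ideal_chain A k I \<longleftrightarrow>
     I 0 \<noteq> {} \<and> (\<forall>j<k. I j \<subset> I (Suc j)) \<and> I k = A \<and> (\<forall>j\<le>k. order_ideal A (I j))"

fun block :: "(nat \<Rightarrow> 'p set) \<Rightarrow> nat \<Rightarrow> 'p set" where
  "block I 0 = I 0"
| "block I (Suc j) = I (Suc j) - I j"

definition chain_cone :: "'p::{finite,order} set \<Rightarrow> nat \<Rightarrow> (nat \<Rightarrow> 'p set) \<Rightarrow> (real, 'p) vec set" where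
  "chain_cone A k I =
     {x \<in> coord_space A.
        (\<forall>j\<le>k. (\<lambda>a. x $ a) constant_on block I j) \<and>
        (\<forall>j<k. \<forall>a\<in>block I j. \<forall>b\<in>block I (Suc j). x $ a \<le> x $ b)}"

definition strict_extensions :: "'p::order set \<Rightarrow> ('p \<Rightarrow> int) \<Rightarrow> ('p \<Rightarrow> int) set" where
  "strict_extensions A l =
     {f. mono f \<and> (\<forall>a\<in>A. f a = l a) \<and>
         (\<forall>p q. p < q \<and> f p = f q \<longrightarrow>
            (\<exists>a\<in>A. \<exists>b\<in>A. l a = l b \<and> a \<le> p \<and> q \<le> b))}"

end

theory Submission
  imports Defs "HOL-Computational_Algebra.Polynomial"
begin

text \<open>
  Replace the order on \<open>P\<close> by the preorder generated by it and by \<open>a \<preceq> b\<close> for all marked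
  \<open>a\<close>, \<open>b\<close> with \<open>\<lambda>(a) \<le> \<lambda>(b)\<close>. For a preorder \<open>R\<close> let \<open>W\<^sub>R(t)\<close> be the number of monotone integral
  extensions of \<open>t\<lambda>\<close>, and \<open>S\<^sub>R\<close> the number of extensions of \<open>\<lambda>\<close> that take equal values on related
  elements only if these are equivalent. If \<open>p\<close> and \<open>q\<close> are incomparable, adding \<open>p \<preceq> q\<close>, or
  \<open>q \<preceq> p\<close>, or both, gives preorders with \<open>W\<^sub>R = W\<^sub>1 + W\<^sub>2 - W\<^sub>1\<^sub>2\<close> and \<open>S\<^sub>R = S\<^sub>1 + S\<^sub>2 + S\<^sub>1\<^sub>2\<close>, and
  the third has one unmarked equivalence class less. So the reciprocity
  \<open>W\<^sub>R(-1) = (-1)\<^sup>d S\<^sub>R\<close>, with \<open>d\<close> the number of unmarked classes, reduces to total preorders. There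
  \<open>W\<^sub>R\<close> is a product of binomial coefficients, one for each gap between consecutive marks, and the
  claim is the negation of the upper index. Finally, \<open>d\<close> is the dimension of the marked order
  polytope, and the polynomial \<open>p\<close> restricted to the line through \<open>\<lambda>\<close> must be \<open>W\<close>.
\<close>

section \<open>Chains with marks\<close>

primrec last_mark :: "nat set \<Rightarrow> nat \<Rightarrow> nat" where
  "last_mark M 0 = 0"
| "last_mark M (Suc n) = (if Suc n \<in> M then Suc n else last_mark M n)"

text \<open>A gap of \<open>m\<close> unmarked positions between marks of values \<open>c\<close>
  and \<open>c + d\<close> has \<open>(d + m) choose m\<close> weakly increasing fillings. With
  \<open>gchoose\<close> each factor is polynomial in \<open>\<mu>\<close> and makes sense for
  negative \<open>d\<close>. Positions after the last mark contribute no factor yet.\<close>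

primrec gap_prod :: "nat set \<Rightarrow> (nat \<Rightarrow> real) \<Rightarrow> nat \<Rightarrow> real" where
  "gap_prod M \<mu> 0 = 1"
| "gap_prod M \<mu> (Suc n) = (if Suc n \<in> M
     then gap_prod M \<mu> n *
       ((\<mu> (Suc n) - \<mu> (last_mark M n) + real (n - last_mark M n)) gchoose (n - last_mark M n))
     else gap_prod M \<mu> n)"

text \<open>The value 0 beyond \<open>n\<close> makes a chain determined by its entries up to
  \<open>n\<close>. The bound \<open>v\<close> stands for the next entry, which permits recursion on
  \<open>n\<close>.\<close>

definition marked_chains :: "nat set \<Rightarrow> (nat \<Rightarrow> int) \<Rightarrow> nat \<Rightarrow> int \<Rightarrow> (nat \<Rightarrow> int) set" where
  "marked_chains M \<mu> n v = {g. (\<forall>i>n. g i = 0) \<and> (\<forall>i<n. g i \<le> g (Suc i)) \<and>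
     (\<forall>i\<le>n. i \<in> M \<longrightarrow> g i = \<mu> i) \<and> g n \<le> v}"

lemma last_mark_le: "last_mark M n \<le> n"
  by (induction n) auto

lemma last_mark_in: "0 \<in> M \<Longrightarrow> last_mark M n \<in> M"
  by (induction n) auto

lemma last_mark_eq: "n \<in> M \<Longrightarrow> last_mark M n = n"
  by (cases n) auto

lemma marked_chains_mono:
  assumes "g \<in> marked_chains M \<mu> n v" "i \<le> j" "j \<le> n"
  shows "g i \<le> g j"
  using assms(2,3)
proof (induction j rule: dec_induct)
  case (step j)
  then have "g i \<le> g j" by simp
  also have "g j \<le> g (Suc j)" using assms(1) step.prems by (simp add: marked_chains_def)
  finally show ?case .
qed simp

lemma marked_chains_empty:
  assumes "0 \<in> M" "v < \<mu> (last_mark M n)"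
  shows "marked_chains M \<mu> n v = {}"
proof -
  have "\<mu> (last_mark M n) \<le> v" if g: "g \<in> marked_chains M \<mu> n v" for g
  proof -
    have "g (last_mark M n) = \<mu> (last_mark M n)"
      using g last_mark_in[OF assms(1)] last_mark_le by (auto simp: marked_chains_def)
    moreover have "g (last_mark M n) \<le> g n"
      using marked_chains_mono[OF g last_mark_le] by simp
    ultimately show ?thesis using g by (auto simp: marked_chains_def)
  qed
  then show ?thesis using assms(2) by force
qed

lemma marked_chains_Suc_mark:
  assumes "Suc n \<in> M" "\<mu> (Suc n) \<le> v"
  shows "marked_chains M \<mu> (Suc n) v = (\<lambda>g. g(Suc n := \<mu> (Suc n))) ` marked_chains M \<mu> n (\<mu> (Suc n))"
proof (intro equalityI subsetI)
  fix g assume g: "g \<in> marked_chains M \<mu> (Suc n) v"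
  have "g(Suc n := 0) \<in> marked_chains M \<mu> n (\<mu> (Suc n))"
    using g assms unfolding marked_chains_def by (auto simp: less_Suc_eq)
  moreover have "g = (g(Suc n := 0))(Suc n := \<mu> (Suc n))"
    using g assms by (auto simp: marked_chains_def)
  ultimately show "g \<in> (\<lambda>g. g(Suc n := \<mu> (Suc n))) ` marked_chains M \<mu> n (\<mu> (Suc n))"
    by blast
next
  fix g assume "g \<in> (\<lambda>g. g(Suc n := \<mu> (Suc n))) ` marked_chains M \<mu> n (\<mu> (Suc n))"
  then show "g \<in> marked_chains M \<mu> (Suc n) v"
    using assms by (auto simp: marked_chains_def less_Suc_eq le_Suc_eq)
qed

lemma marked_chains_Suc_free:
  assumes "Suc n \<notin> M"
  shows "marked_chains M \<mu> (Suc n) v = (\<Union>u\<in>{..v}. (\<lambda>g. g(Suc n := u)) ` marked_chains M \<mu> n u)"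
proof (intro equalityI subsetI)
  fix g assume g: "g \<in> marked_chains M \<mu> (Suc n) v"
  have "g(Suc n := 0) \<in> marked_chains M \<mu> n (g (Suc n))"
    using g assms unfolding marked_chains_def by (auto simp: less_Suc_eq)
  moreover have "g = (g(Suc n := 0))(Suc n := g (Suc n))" by auto
  moreover have "g (Suc n) \<le> v" using g by (auto simp: marked_chains_def)
  ultimately show "g \<in> (\<Union>u\<in>{..v}. (\<lambda>g. g(Suc n := u)) ` marked_chains M \<mu> n u)"
    by blast
next
  fix g assume "g \<in> (\<Union>u\<in>{..v}. (\<lambda>g. g(Suc n := u)) ` marked_chains M \<mu> n u)"
  then show "g \<in> marked_chains M \<mu> (Suc n) v"
    using assms by (auto simp: marked_chains_def less_Suc_eq le_Suc_eq)
qed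

text \<open>The overwritten entry is 0 for every chain in the domain, so nothing is lost.\<close>

lemma inj_on_upd_marked_chains: "inj_on (\<lambda>g. g(Suc n := u)) (marked_chains M \<mu> n w)"
proof (rule inj_onI)
  fix g h assume gh: "g \<in> marked_chains M \<mu> n w" "h \<in> marked_chains M \<mu> n w"
    and eq: "g(Suc n := u) = h(Suc n := u)"
  show "g = h"
  proof
    fix i show "g i = h i"
      using gh fun_cong[OF eq, of i] by (cases "i = Suc n") (auto simp: marked_chains_def)
  qed
qed

text \<open>
  The marks need not increase: the hypothesis also admits \<open>\<lambda>i. \<mu> i - int i\<close> for strictly increasing
  \<open>\<mu>\<close>, which turns the count of strict chains into one of weak chains.
\<close>

lemma card_marked_chains:
  assumes 0: "0 \<in> M"
    and \<mu>: "\<And>i j. i \<in> M \<Longrightarrow> j \<in> M \<Longrightarrow> i < j \<Longrightarrow> j \<le> n \<Longrightarrow> \<mu> i + int i < \<mu> j + int j"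
    and v: "\<mu> (last_mark M n) - int (n - last_mark M n) \<le> v"
  shows "finite (marked_chains M \<mu> n v) \<and>
    real (card (marked_chains M \<mu> n v)) = gap_prod M (\<lambda>i. real_of_int (\<mu> i)) n *
      ((real_of_int (v - \<mu> (last_mark M n)) + real (n - last_mark M n)) gchoose (n - last_mark M n))"
  using \<mu> v
proof (induction n arbitrary: v)
  case 0
  have "marked_chains M \<mu> 0 v = {(\<lambda>_. 0)(0 := \<mu> 0)}"
    using assms(1) 0 by (auto simp: marked_chains_def fun_eq_iff)
  then show ?case by simp
next
  case (Suc n)
  let ?c = "\<mu> (last_mark M n)" and ?m = "n - last_mark M n"
  show ?case
  proof (cases "Suc n \<in> M")
    case True
    have lt: "last_mark M n < Suc n" using last_mark_le[of M n] by simp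
    have "?c + int (last_mark M n) < \<mu> (Suc n) + int (Suc n)"
      using Suc.prems(1)[OF last_mark_in[OF 0] True lt] by simp
    then have "?c - int ?m \<le> \<mu> (Suc n)" using last_mark_le[of M n] by linarith
    with Suc.IH[of "\<mu> (Suc n)"] Suc.prems(1)
    have "finite (marked_chains M \<mu> n (\<mu> (Suc n)))"
      "real (card (marked_chains M \<mu> n (\<mu> (Suc n)))) = gap_prod M (\<lambda>i. real_of_int (\<mu> i)) (Suc n)"
      using True by auto
    moreover have "\<mu> (Suc n) \<le> v" using Suc.prems(2) True by simp
    ultimately show ?thesis
      using True by (simp add: marked_chains_Suc_mark card_image inj_on_upd_marked_chains del: gap_prod.simps)
  next
    case False
    let ?K = "gap_prod M (\<lambda>i. real_of_int (\<mu> i)) n"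
    let ?B = "\<lambda>u. (\<lambda>g. g(Suc n := u)) ` marked_chains M \<mu> n u"
    have mle: "last_mark M n \<le> n" by (rule last_mark_le)
    \<comment> \<open>The case \<open>v = ?c - ?m - 1\<close> can occur; then the sum over
      \<open>u\<close> is empty and the binomial coefficient is 0.\<close>
    have v: "?c - int ?m - 1 \<le> v" using Suc.prems(2) False mle by simp
    have ih: "finite (marked_chains M \<mu> n u)"
      "real (card (marked_chains M \<mu> n u)) = ?K * ((real_of_int (u - ?c) + real ?m) gchoose ?m)"
      if "?c - int ?m \<le> u" for u
      using Suc.IH[of u] Suc.prems(1) that by auto
    have "marked_chains M \<mu> (Suc n) v = (\<Union>u\<in>{..v}. ?B u)"
      by (rule marked_chains_Suc_free[OF False])
    \<comment> \<open>The sum starts at \<open>?c - ?m\<close> instead of \<open>?c\<close>: the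
      terms below \<open>?c\<close> vanish, and the shift \<open>j = u - ?c + ?m\<close> then runs
      over all \<open>j\<close> from 0, as the hockey-stick identity requires.\<close>
    also have "\<dots> = (\<Union>u\<in>{?c - int ?m..v}. ?B u)"
    proof -
      have "?B u = {}" if "u < ?c - int ?m" for u
        using marked_chains_empty[OF 0, of u \<mu> n] that by simp
      then show ?thesis by (force simp: not_le)
    qed
    finally have eq: "marked_chains M \<mu> (Suc n) v = (\<Union>u\<in>{?c - int ?m..v}. ?B u)" .
    have disj: "?B u \<inter> ?B w = {}" if "u \<noteq> w" for u w
      using that by (auto simp: fun_eq_iff dest!: spec[of _ "Suc n"])
    have fin: "finite (marked_chains M \<mu> (Suc n) v)"
      unfolding eq using ih(1) by auto
    have "card (marked_chains M \<mu> (Suc n) v) = (\<Sum>u\<in>{?c - int ?m..v}. card (?B u))"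
      unfolding eq using ih(1) disj by (subst card_UN_disjoint) auto
    also have "\<dots> = (\<Sum>u\<in>{?c - int ?m..v}. card (marked_chains M \<mu> n u))"
      by (simp add: card_image inj_on_upd_marked_chains)
    finally have "real (card (marked_chains M \<mu> (Suc n) v))
        = (\<Sum>u\<in>{?c - int ?m..v}. ?K * ((real_of_int (u - ?c) + real ?m) gchoose ?m))"
      using ih(2) by simp
    also have "\<dots> = ?K * (\<Sum>u\<in>{?c - int ?m..v}. ((real_of_int (u - ?c) + real ?m) gchoose ?m))"
      by (simp add: sum_distrib_left)
    also have "(\<Sum>u\<in>{?c - int ?m..v}. ((real_of_int (u - ?c) + real ?m) gchoose ?m))
        = (\<Sum>j<nat (v - ?c + int ?m + 1). real (j choose ?m))"
      by (rule sum.reindex_bij_witness[where i = "\<lambda>j. int j + ?c - int ?m" and j = "\<lambda>u. nat (u - ?c + int ?m)"])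
        (auto simp: binomial_gbinomial)
    also have "\<dots> = real (nat (v - ?c + int ?m + 1) choose Suc ?m)"
    proof -
      have "(\<Sum>j<N. j choose k) = N choose Suc k" for N k :: nat
        by (induction N) auto
      then show ?thesis by (metis of_nat_sum)
    qed
    also have "\<dots> = (real_of_int (v - ?c) + real (Suc ?m)) gchoose Suc ?m"
      using v by (simp add: binomial_gbinomial algebra_simps)
    finally show ?thesis using fin False mle by (simp add: Suc_diff_le)
  qed
qed

section \<open>Sign change and polynomiality of the product over gaps\<close>

text \<open>Negating the upper index turns \<open>(m - d) gchoose m\<close> into
  \<open>(-1) ^ m * ((d - 1) gchoose m)\<close>, the number of strictly increasing fillings of a gap
  for \<open>d \<ge> 1\<close>; shifting the marks by their positions gives the same top
  \<open>d - 1\<close>. The power on the left accounts for the positions after the last mark, whose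
  factor is still to come.\<close>

lemma gap_prod_uminus:
  assumes "0 \<in> M"
  shows "(-1) ^ (n - last_mark M n) * gap_prod M (\<lambda>i. - \<mu> i) n
    = (-1) ^ card ({..n} - M) * gap_prod M (\<lambda>i. \<mu> i - real i) n"
proof (induction n)
  case 0
  then show ?case using assms by simp
next
  case (Suc n)
  have le: "last_mark M n \<le> n" by (rule last_mark_le)
  show ?case
  proof (cases "Suc n \<in> M")
    case True
    let ?m = "n - last_mark M n" and ?\<Delta> = "\<mu> (Suc n) - \<mu> (last_mark M n)"
    have "(- ?\<Delta> + real ?m) gchoose ?m = (-1) ^ ?m * ((?\<Delta> - 1) gchoose ?m)"
      by (subst gbinomial_negated_upper) simp
    moreover have "{..Suc n} - M = {..n} - M" using True by (auto simp: le_Suc_eq)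
    ultimately show ?thesis
      using True Suc.IH le by (simp add: algebra_simps of_nat_diff)
  next
    case False
    have "{..Suc n} - M = insert (Suc n) ({..n} - M)" using False by (auto simp: le_Suc_eq)
    then show ?thesis
      using False Suc.IH le by (simp add: Suc_diff_le)
  qed
qed

lemma poly_gap_prod: "\<exists>w. \<forall>t. poly w t = gap_prod M (\<lambda>i. t * \<mu> i) n"
proof (induction n)
  case 0
  show ?case by (rule exI[of _ 1]) simp
next
  case (Suc n)
  then obtain w where w: "\<And>t. poly w t = gap_prod M (\<lambda>i. t * \<mu> i) n" by blast
  let ?m = "n - last_mark M n" and ?\<Delta> = "\<mu> (Suc n) - \<mu> (last_mark M n)"
  let ?b = "smult (1 / fact ?m) (\<Prod>i = 0..<?m. [:real ?m - real i, ?\<Delta>:])"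
  have "poly ?b t = (t * ?\<Delta> + real ?m) gchoose ?m" for t
    by (simp add: gbinomial_prod_rev poly_prod algebra_simps)
  moreover have "t * \<mu> (Suc n) - t * \<mu> (last_mark M n) = t * ?\<Delta>" for t
    by (simp add: algebra_simps)
  ultimately have "poly (w * ?b) t = gap_prod M (\<lambda>i. t * \<mu> i) (Suc n)" if "Suc n \<in> M" for t
    using that w by (simp only: poly_mult gap_prod.simps if_True)
  then show ?case
    using w by (cases "Suc n \<in> M") (blast, auto)
qed

section \<open>Reciprocity for marked preorders\<close>

text \<open>The prescribed values \<open>h\<close> are kept apart from \<open>l\<close>: they will
  be multiples of \<open>l\<close>, and also \<open>l\<close> minus a rank, which need not be
  monotone on the marks.\<close>

definition weak_ext :: "('a \<times> 'a) set \<Rightarrow> 'a set \<Rightarrow> ('a \<Rightarrow> int) \<Rightarrow> ('a \<Rightarrow> int) set" where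
  "weak_ext R A h = {f. (\<forall>(x, y)\<in>R. f x \<le> f y) \<and> (\<forall>a\<in>A. f a = h a)}"

definition strict_ext :: "('a \<times> 'a) set \<Rightarrow> 'a set \<Rightarrow> ('a \<Rightarrow> int) \<Rightarrow> ('a \<Rightarrow> int) set" where
  "strict_ext R A h = {f \<in> weak_ext R A h. \<forall>(x, y)\<in>R. f x = f y \<longrightarrow> (y, x) \<in> R}"

lemma weak_extD: "f \<in> weak_ext R A h \<Longrightarrow> (x, y) \<in> R \<Longrightarrow> f x \<le> f y"
  by (auto simp: weak_ext_def)

lemma strict_ext_weak: "f \<in> strict_ext R A h \<Longrightarrow> f \<in> weak_ext R A h"
  by (simp add: strict_ext_def)

lemma strict_extD: "f \<in> strict_ext R A h \<Longrightarrow> (x, y) \<in> R \<Longrightarrow> f x = f y \<Longrightarrow> (y, x) \<in> R"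
  by (auto simp: strict_ext_def)

text \<open>On \<open>A\<close> the relation is the total preorder given by \<open>l\<close>, which
  later enlargements must preserve. The last clause bounds each element by marks, which makes the
  sets of extensions finite and puts marks at both ends of a total preorder.\<close>

definition marked_preorder :: "'a set \<Rightarrow> ('a \<Rightarrow> int) \<Rightarrow> ('a \<times> 'a) set \<Rightarrow> bool" where
  "marked_preorder A l R \<longleftrightarrow> refl R \<and> trans R \<and> (\<forall>a\<in>A. \<forall>b\<in>A. (a, b) \<in> R \<longleftrightarrow> l a \<le> l b) \<and>
     (\<forall>x. \<exists>a\<in>A. \<exists>b\<in>A. (a, x) \<in> R \<and> (x, b) \<in> R)"

text \<open>\<open>T\<close> represents the classes of \<open>R \<inter> R\<inverse>\<close> without marks, so \<open>card T\<close> is their number.\<close>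

definition free_transversal :: "'a set \<Rightarrow> ('a \<times> 'a) set \<Rightarrow> 'a set \<Rightarrow> bool" where
  "free_transversal A R T \<longleftrightarrow>
     (\<forall>t\<in>T. \<forall>a\<in>A. (t, a) \<notin> R \<inter> R\<inverse>) \<and> (\<forall>s\<in>T. \<forall>t\<in>T. (s, t) \<in> R \<inter> R\<inverse> \<longrightarrow> s = t) \<and>
     (\<forall>x. \<exists>y\<in>A \<union> T. (x, y) \<in> R \<inter> R\<inverse>)"

lemma free_transversal_markD:
  "free_transversal A R T \<Longrightarrow> t \<in> T \<Longrightarrow> a \<in> A \<Longrightarrow> (t, a) \<in> R \<Longrightarrow> (a, t) \<in> R \<Longrightarrow> False"
  by (auto simp: free_transversal_def)

lemma free_transversal_uniqueD:
  "free_transversal A R T \<Longrightarrow> s \<in> T \<Longrightarrow> t \<in> T \<Longrightarrow> (s, t) \<in> R \<Longrightarrow> (t, s) \<in> R \<Longrightarrow> s = t"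
  by (auto simp: free_transversal_def)

lemma free_transversal_coverE:
  assumes "free_transversal A R T"
  obtains y where "y \<in> A \<union> T" "(x, y) \<in> R" "(y, x) \<in> R"
  using assms unfolding free_transversal_def by blast

section \<open>Total preorders\<close>

text \<open>The size of its down-set locates an element, since by totality a failing relation makes
  one down-set a proper subset of the other. These sizes can skip values; enumerating them in
  increasing order closes the gaps.\<close>

lemma total_preorder_rank:
  fixes R :: "('a::finite \<times> 'a) set"
  assumes "refl R" "trans R" and total: "\<And>x y. (x, y) \<in> R \<or> (y, x) \<in> R"
  obtains r :: "'a \<Rightarrow> nat" and n where "\<And>x y. (x, y) \<in> R \<longleftrightarrow> r x \<le> r y" "range r = {..n}"
proof -
  define c where "c x = card {z. (z, x) \<in> R}" for x
  have c: "(x, y) \<in> R \<longleftrightarrow> c x \<le> c y" for x y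
  proof
    assume "(x, y) \<in> R"
    then show "c x \<le> c y"
      unfolding c_def using \<open>trans R\<close> by (intro card_mono) (auto dest: transD)
  next
    assume le: "c x \<le> c y"
    show "(x, y) \<in> R"
    proof (rule ccontr)
      assume n: "(x, y) \<notin> R"
      then have yx: "(y, x) \<in> R" using total by blast
      have "{z. (z, y) \<in> R} \<subset> {z. (z, x) \<in> R}"
        using yx n \<open>trans R\<close> reflD[OF \<open>refl R\<close>, of x] by (auto dest: transD)
      then have "c y < c x" unfolding c_def by (intro psubset_card_mono) auto
      with le show False by simp
    qed
  qed
  obtain h where h: "bij_betw h {..<card (range c)} (range c)" "strict_mono_on {..<card (range c)} h"
    using ex_bij_betw_strict_mono_card[of "range c"] by auto
  let ?N = "card (range c)"
  define r where "r x = inv_into {..<?N} h (c x)" for x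
  have hr: "h (r x) = c x" for x
    unfolding r_def using h(1) by (intro f_inv_into_f) (auto simp: bij_betw_def)
  have r: "r x \<in> {..<?N}" for x
    unfolding r_def using h(1) by (intro inv_into_into) (auto simp: bij_betw_def)
  have "c x \<le> c y \<longleftrightarrow> r x \<le> r y" for x y
    using strict_mono_on_less_eq[OF h(2) r r, of x y] hr by simp
  then have "(x, y) \<in> R \<longleftrightarrow> r x \<le> r y" for x y
    using c by simp
  moreover have "range r = inv_into {..<?N} h ` range c"
    unfolding r_def by auto
  then have "range r = {..<?N}"
    using bij_betw_imp_surj_on[OF bij_betw_inv_into[OF h(1)]] by simp
  moreover obtain n where "?N = Suc n"
    using not0_implies_Suc[of ?N] by auto
  ultimately show thesis
    using that[of r n] by (simp only: lessThan_Suc_atMost)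
qed

text \<open>Monotone functions factor through the rank. The bound of the chains is set to
  \<open>\<mu> n\<close>, the value at the marked rank \<open>n\<close>.\<close>

lemma bij_betw_marked_chains_weak_ext:
  assumes r: "\<And>x y. (x, y) \<in> R \<longleftrightarrow> r x \<le> r y" "range r = {..n}"
    and h: "\<And>a. a \<in> A \<Longrightarrow> h a = \<mu> (r a)" and n: "n \<in> r ` A"
  shows "bij_betw (\<lambda>g. g \<circ> r) (marked_chains (r ` A) \<mu> n (\<mu> n)) (weak_ext R A h)"
proof (rule bij_betw_imageI)
  show "inj_on (\<lambda>g. g \<circ> r) (marked_chains (r ` A) \<mu> n (\<mu> n))"
  proof (rule inj_onI)
    fix g g' assume g: "g \<in> marked_chains (r ` A) \<mu> n (\<mu> n)" "g' \<in> marked_chains (r ` A) \<mu> n (\<mu> n)"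
      and eq: "g \<circ> r = g' \<circ> r"
    show "g = g'"
    proof
      fix i show "g i = g' i"
      proof (cases "i \<le> n")
        case True
        then obtain x where "i = r x" using r(2) by (metis atMost_iff image_iff)
        then show ?thesis using fun_cong[OF eq, of x] by simp
      qed (use g in \<open>auto simp: marked_chains_def\<close>)
    qed
  qed
  have rn: "r x \<le> n" for x using r(2) by auto
  show "(\<lambda>g. g \<circ> r) ` marked_chains (r ` A) \<mu> n (\<mu> n) = weak_ext R A h"
  proof (intro equalityI subsetI)
    fix f assume "f \<in> (\<lambda>g. g \<circ> r) ` marked_chains (r ` A) \<mu> n (\<mu> n)"
    then obtain g where g: "g \<in> marked_chains (r ` A) \<mu> n (\<mu> n)" and f: "f = g \<circ> r" by blast
    show "f \<in> weak_ext R A h"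
      using marked_chains_mono[OF g] g rn h r(1) by (auto simp: f weak_ext_def marked_chains_def)
  next
    fix f assume f: "f \<in> weak_ext R A h"
    define g where "g i = (if i \<le> n then f (inv r i) else 0)" for i
    have ri: "r (inv r i) = i" if "i \<le> n" for i
      using that r(2) by (intro f_inv_into_f) auto
    have fr: "f x \<le> f y" if "r x \<le> r y" for x y
      using weak_extD[OF f] r(1) that by blast
    have gr: "g (r x) = f x" for x
      unfolding g_def using ri[OF rn[of x]] rn by (auto intro!: antisym fr)
    have "g i \<le> g (Suc i)" if "i < n" for i
      using that ri[of i] ri[of "Suc i"] by (auto simp: g_def intro: fr)
    moreover have ga: "g (r a) = \<mu> (r a)" if "a \<in> A" for a
      using that f h by (auto simp: gr weak_ext_def)
    moreover have "g n = \<mu> n" using n ga by blast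
    moreover have "g i = 0" if "i > n" for i using that by (simp add: g_def)
    ultimately have "g \<in> marked_chains (r ` A) \<mu> n (\<mu> n)"
      by (auto simp: marked_chains_def)
    moreover have "f = g \<circ> r" using gr by auto
    ultimately show "f \<in> (\<lambda>g. g \<circ> r) ` marked_chains (r ` A) \<mu> n (\<mu> n)" by blast
  qed
qed

text \<open>Classes are ranks, so the weak count is a product over gaps. Subtracting the rank makes
  strict extensions weak, and \<open>gap_prod_uminus\<close> compares the two products.\<close>

lemma reciprocity_total:
  fixes R :: "('a::finite \<times> 'a) set"
  assumes R: "marked_preorder A l R" and total: "\<And>x y. (x, y) \<in> R \<or> (y, x) \<in> R"
    and T: "free_transversal A R T"
  shows "\<exists>w. (\<forall>t\<ge>1. real (card (weak_ext R A (\<lambda>a. int t * l a))) = poly w (real t)) \<and>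
    poly w (-1) = (-1) ^ card T * real (card (strict_ext R A l))"
proof -
  obtain r :: "'a \<Rightarrow> nat" and n where r: "\<And>x y. (x, y) \<in> R \<longleftrightarrow> r x \<le> r y" "range r = {..n}"
    using total_preorder_rank[of R] R total unfolding marked_preorder_def by metis
  let ?M = "r ` A"
  have rn: "r x \<le> n" for x using r(2) by auto
  have lr: "l a \<le> l b \<longleftrightarrow> r a \<le> r b" if "a \<in> A" "b \<in> A" for a b
    using that R r(1) by (auto simp: marked_preorder_def)
  have bnd: "\<exists>a\<in>A. \<exists>b\<in>A. r a \<le> r x \<and> r x \<le> r b" for x
    using R r(1) by (auto simp: marked_preorder_def)
  have ends: "0 \<in> ?M" "n \<in> ?M"
  proof -
    obtain x y where xy: "r x = 0" "r y = n"
      using r(2) by (metis atMost_iff image_iff le0 order_refl)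
    obtain a where "a \<in> A" "r a \<le> r x" using bnd by blast
    with xy show "0 \<in> ?M" by force
    obtain b where "b \<in> A" "r y \<le> r b" using bnd by blast
    with xy rn[of b] have "n = r b" by simp
    with \<open>b \<in> A\<close> show "n \<in> ?M" by blast
  qed
  \<comment> \<open>This is \<open>l\<close> transported to ranks; the chosen mark does not matter,
    as marks of equal rank have equal value.\<close>
  define \<mu> where "\<mu> i = l (inv_into A r i)" for i
  have \<mu>: "\<mu> (r a) = l a" if "a \<in> A" for a
  proof -
    have "inv_into A r (r a) \<in> A" "r (inv_into A r (r a)) = r a"
      using that by (auto intro: inv_into_into f_inv_into_f)
    then show ?thesis unfolding \<mu>_def using lr[OF that] lr[OF _ that] by (intro antisym) auto
  qed
  have \<mu>_less: "\<mu> i < \<mu> j" if "i \<in> ?M" "j \<in> ?M" "i < j" for i j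
    using that \<mu> lr by (force simp: not_le[symmetric])
  \<comment> \<open>Applied to \<open>t * \<mu> i\<close> for the weak count and to
    \<open>\<mu> i - i\<close> for the strict one. The second need not increase, whence the form of
    the hypothesis on \<open>\<nu>\<close>.\<close>
  have card_weak: "real (card (weak_ext R A h)) = gap_prod ?M (\<lambda>i. real_of_int (\<nu> i)) n"
    if "\<And>a. a \<in> A \<Longrightarrow> h a = \<nu> (r a)"
      and "\<And>i j. i \<in> ?M \<Longrightarrow> j \<in> ?M \<Longrightarrow> i < j \<Longrightarrow> \<nu> i + int i < \<nu> j + int j" for h \<nu>
  proof -
    have "bij_betw (\<lambda>g. g \<circ> r) (marked_chains ?M \<nu> n (\<nu> n)) (weak_ext R A h)"
      by (rule bij_betw_marked_chains_weak_ext) (use r that(1) ends(2) in auto)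
    then have "card (weak_ext R A h) = card (marked_chains ?M \<nu> n (\<nu> n))"
      using bij_betw_same_card by metis
    then show ?thesis
      using card_marked_chains[OF ends(1), of n \<nu> "\<nu> n"] that(2) last_mark_eq[OF ends(2)] by simp
  qed
  obtain w where w: "\<And>t. poly w t = gap_prod ?M (\<lambda>i. t * real_of_int (\<mu> i)) n"
    using poly_gap_prod[of ?M "\<lambda>i. real_of_int (\<mu> i)" n] by blast
  have "real (card (weak_ext R A (\<lambda>a. int t * l a))) = poly w (real t)" if "t \<ge> 1" for t
  proof -
    have "int t * \<mu> i + int i < int t * \<mu> j + int j" if "i \<in> ?M" "j \<in> ?M" "i < j" for i j
      using mult_left_mono[OF less_imp_le[OF \<mu>_less[OF that]], of "int t"] that(3) by simp
    then show ?thesis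
      using card_weak[of "\<lambda>a. int t * l a" "\<lambda>i. int t * \<mu> i"] \<mu> by (simp add: w)
  qed
  moreover have "poly w (-1) = (-1) ^ card T * real (card (strict_ext R A l))"
  proof -
    have "bij_betw (\<lambda>f x. f x - int (r x)) (strict_ext R A l) (weak_ext R A (\<lambda>a. l a - int (r a)))"
    proof (rule bij_betw_byWitness[where f' = "\<lambda>f x. f x + int (r x)"])
      show "(\<lambda>f x. f x - int (r x)) ` strict_ext R A l \<subseteq> weak_ext R A (\<lambda>a. l a - int (r a))"
      proof clarify
        fix f assume f: "f \<in> strict_ext R A l"
        \<comment> \<open>Every rank between \<open>r x\<close> and \<open>r y\<close> is attained,
          and a strict extension rises by at least 1 from each rank to the next.\<close>
        have step: "f x + int j \<le> f y" if "r y = r x + j" for x y j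
          using that
        proof (induction j arbitrary: y)
          case 0
          then show ?case using weak_extD[OF strict_ext_weak[OF f]] r(1) by simp
        next
          case (Suc j)
          obtain z where z: "r z = r x + j"
            using r(2) Suc.prems rn[of y] by (metis add_Suc_right atMost_iff image_iff Suc_leD)
          have "(z, y) \<in> R" "(y, z) \<notin> R" using z Suc.prems r(1) by auto
          then have "f z < f y" 
            using weak_extD[OF strict_ext_weak[OF f]] strict_extD[OF f] by (meson order_less_le)
          then show ?case using Suc.IH[OF z] by simp
        qed
        have "f x - int (r x) \<le> f y - int (r y)" if "r x \<le> r y" for x y
          using step[of y x "r y - r x"] that by simp
        then show "(\<lambda>x. f x - int (r x)) \<in> weak_ext R A (\<lambda>a. l a - int (r a))"
          using f r(1) by (auto simp: strict_ext_def weak_ext_def)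
      qed
    qed (auto simp: strict_ext_def weak_ext_def r(1))
    then have "card (strict_ext R A l) = card (weak_ext R A (\<lambda>a. l a - int (r a)))"
      by (rule bij_betw_same_card)
    then have strict: "real (card (strict_ext R A l)) = gap_prod ?M (\<lambda>i. real_of_int (\<mu> i) - real i) n"
      using card_weak[of "\<lambda>a. l a - int (r a)" "\<lambda>i. \<mu> i - int i"] \<mu> \<mu>_less by simp
    \<comment> \<open>Unmarked classes are unmarked ranks, so \<open>card T\<close> is the exponent
      in \<open>gap_prod_uminus\<close>.\<close>
    have "bij_betw r T ({..n} - ?M)"
    proof (rule bij_betw_imageI)
      show "inj_on r T"
        using free_transversal_uniqueD[OF T] r(1) by (simp add: inj_on_def)
      show "r ` T = {..n} - ?M"
      proof (intro equalityI subsetI)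
        fix i assume "i \<in> r ` T"
        then obtain t where t: "t \<in> T" "i = r t" by blast
        have "r t \<noteq> r a" if "a \<in> A" for a
          using free_transversal_markD[OF T t(1) that] r(1) by force
        then show "i \<in> {..n} - ?M" using t rn by auto
      next
        fix i assume i: "i \<in> {..n} - ?M"
        then obtain x where x: "i = r x" using r(2) by (metis DiffD1 image_iff)
        obtain y where "y \<in> A \<union> T" "(x, y) \<in> R" "(y, x) \<in> R"
          by (rule free_transversal_coverE[OF T])
        then have "r x = r y" using r(1) by auto
        with \<open>y \<in> A \<union> T\<close> i x show "i \<in> r ` T" by auto
      qed
    qed
    then have "card T = card ({..n} - ?M)" by (rule bij_betw_same_card)
    then show ?thesis
      using gap_prod_uminus[OF ends(1), of n "\<lambda>i. real_of_int (\<mu> i)"] last_mark_eq[OF ends(2)]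
      by (simp add: w strict)
  qed
  ultimately show ?thesis by blast
qed

section \<open>Relating two incomparable elements\<close>

text \<open>For a preorder \<open>R\<close> this is the preorder generated by \<open>R\<close> and
  \<open>(p, q)\<close>: a path using the new pair repeatedly can be cut to its first arrival at
  \<open>p\<close> and its last departure from \<open>q\<close>.\<close>

definition add_rel :: "'a \<Rightarrow> 'a \<Rightarrow> ('a \<times> 'a) set \<Rightarrow> ('a \<times> 'a) set" where
  "add_rel p q R = R \<union> {(x, y). (x, p) \<in> R \<and> (q, y) \<in> R}"

text \<open>For a preorder \<open>R\<close> the union is already transitive: a path using one new
  pair and then the other comes back to where it left \<open>R\<close>.\<close>

definition merge_rel :: "'a \<Rightarrow> 'a \<Rightarrow> ('a \<times> 'a) set \<Rightarrow> ('a \<times> 'a) set" where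
  "merge_rel p q R = add_rel p q R \<union> add_rel q p R"

lemma marked_preorder_reflD: "marked_preorder A l R \<Longrightarrow> (x, x) \<in> R"
  by (auto simp: marked_preorder_def refl_on_def)

lemma marked_preorder_transD: "marked_preorder A l R \<Longrightarrow> (x, y) \<in> R \<Longrightarrow> (y, z) \<in> R \<Longrightarrow> (x, z) \<in> R"
  by (auto simp: marked_preorder_def dest: transD)

lemma marked_preorder_marksD:
  "marked_preorder A l R \<Longrightarrow> a \<in> A \<Longrightarrow> b \<in> A \<Longrightarrow> (a, b) \<in> R \<longleftrightarrow> l a \<le> l b"
  by (auto simp: marked_preorder_def)

context
  fixes A :: "'a set" and l R p q
  assumes R: "marked_preorder A l R" and pq: "(p, q) \<notin> R" and qp: "(q, p) \<notin> R"
begin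

text \<open>A new relation from a mark \<open>a\<close> to a mark \<open>b\<close> with
  \<open>l b < l a\<close> would make \<open>q\<close>, \<open>b\<close>, \<open>a\<close>,
  \<open>p\<close> an ascending chain in \<open>R\<close>, against incomparability.\<close>

lemma marked_preorder_add_rel: "marked_preorder A l (add_rel p q R)"
proof -
  note refl = marked_preorder_reflD[OF R] and trans = marked_preorder_transD[OF R]
    and marks = marked_preorder_marksD[OF R]
  have "trans (add_rel p q R)"
    using trans unfolding trans_def add_rel_def by blast
  moreover have "(a, b) \<in> R" if "(a, b) \<in> add_rel p q R" "a \<in> A" "b \<in> A" for a b
  proof (rule ccontr)
    assume "(a, b) \<notin> R"
    then have "(b, a) \<in> R" using marks that(2,3) by auto
    then show False using that(1) \<open>(a, b) \<notin> R\<close> trans qp unfolding add_rel_def by blast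
  qed
  moreover have "R \<subseteq> add_rel p q R" by (auto simp: add_rel_def)
  ultimately show ?thesis
    using R unfolding marked_preorder_def refl_on_def by (intro conjI; blast)
qed

lemma marked_preorder_merge_rel: "marked_preorder A l (merge_rel p q R)"
proof -
  note refl = marked_preorder_reflD[OF R] and trans = marked_preorder_transD[OF R]
    and marks = marked_preorder_marksD[OF R]
  have "trans (merge_rel p q R)"
    using trans unfolding trans_def merge_rel_def add_rel_def by blast
  moreover have "(a, b) \<in> R" if "(a, b) \<in> merge_rel p q R" "a \<in> A" "b \<in> A" for a b
  proof (rule ccontr)
    assume "(a, b) \<notin> R"
    then have "(b, a) \<in> R" using marks that(2,3) by auto
    then show False using that(1) \<open>(a, b) \<notin> R\<close> trans pq qp unfolding merge_rel_def add_rel_def by blast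
  qed
  moreover have "R \<subseteq> merge_rel p q R" by (auto simp: merge_rel_def add_rel_def)
  ultimately show ?thesis
    using R unfolding marked_preorder_def refl_on_def by (intro conjI; blast)
qed

text \<open>A cycle through the new pair would put \<open>q\<close> below \<open>p\<close> in
  \<open>R\<close>. So the classes, and with them the free transversals, stay the same.\<close>

lemma add_rel_kernel: "add_rel p q R \<inter> (add_rel p q R)\<inverse> = R \<inter> R\<inverse>"
  using marked_preorder_transD[OF R] pq qp unfolding add_rel_def by blast

text \<open>A cycle through only one of the new pairs would make \<open>p\<close> and
  \<open>q\<close> comparable, so a new equivalence uses both. Hence only the classes of
  \<open>p\<close> and \<open>q\<close> fuse.\<close>

lemma merge_rel_kernel:
  assumes "(x, y) \<in> merge_rel p q R \<inter> (merge_rel p q R)\<inverse>"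
  shows "(x, y) \<in> R \<inter> R\<inverse> \<or> (x, p) \<in> R \<inter> R\<inverse> \<and> (y, q) \<in> R \<inter> R\<inverse>
    \<or> (x, q) \<in> R \<inter> R\<inverse> \<and> (y, p) \<in> R \<inter> R\<inverse>"
  using assms marked_preorder_transD[OF R] pq qp unfolding merge_rel_def add_rel_def by blast

lemma free_transversal_add_rel: "free_transversal A R T \<Longrightarrow> free_transversal A (add_rel p q R) T"
  by (simp add: free_transversal_def add_rel_kernel)

text \<open>The class of \<open>p\<close>, being unmarked, has a representative \<open>t\<close> in
  \<open>T\<close>. After the fusion the class of \<open>q\<close>, marked or not, supplies the
  representative, so \<open>t\<close> is dropped.\<close>

lemma free_transversal_merge_rel:
  assumes T: "free_transversal A R T" and p: "\<And>a. a \<in> A \<Longrightarrow> (p, a) \<notin> R \<inter> R\<inverse>"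
  shows "\<exists>t\<in>T. free_transversal A (merge_rel p q R) (T - {t})"
proof -
  note refl = marked_preorder_reflD[OF R] and trans = marked_preorder_transD[OF R]
  obtain t where "t \<in> A \<union> T" and pt: "(p, t) \<in> R" "(t, p) \<in> R"
    by (rule free_transversal_coverE[OF T])
  with p have t: "t \<in> T" by blast
  have uniq: "s = t" if "s \<in> T" "(s, p) \<in> R \<inter> R\<inverse>" for s
  proof (rule free_transversal_uniqueD[OF T that(1) t])
    show "(s, t) \<in> R" using that(2) pt(1) by (intro trans[of s p t]) auto
    show "(t, s) \<in> R" using that(2) pt(2) by (intro trans[of t p s]) auto
  qed
  have sub: "R \<subseteq> merge_rel p q R" by (auto simp: merge_rel_def add_rel_def)
  show ?thesis
    unfolding free_transversal_def
  proof (intro bexI[OF _ t] conjI ballI allI impI)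
    fix s a assume s: "s \<in> T - {t}" and a: "a \<in> A"
    show "(s, a) \<notin> merge_rel p q R \<inter> (merge_rel p q R)\<inverse>"
    proof
      assume "(s, a) \<in> merge_rel p q R \<inter> (merge_rel p q R)\<inverse>"
      from merge_rel_kernel[OF this] consider "(s, a) \<in> R \<inter> R\<inverse>" | "(s, p) \<in> R \<inter> R\<inverse>"
        | "(a, p) \<in> R \<inter> R\<inverse>" by blast
      then show False
      proof cases
        case 1
        then show ?thesis using free_transversal_markD[OF T _ a] s by blast
      next
        case 2
        then show ?thesis using uniq s by blast
      next
        case 3
        then show ?thesis using p[OF a] by blast
      qed
    qed
  next
    fix s s' assume s: "s \<in> T - {t}" "s' \<in> T - {t}"
      and "(s, s') \<in> merge_rel p q R \<inter> (merge_rel p q R)\<inverse>"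
    from merge_rel_kernel[OF this(3)] consider "(s, s') \<in> R \<inter> R\<inverse>" | "(s, p) \<in> R \<inter> R\<inverse>"
      | "(s', p) \<in> R \<inter> R\<inverse>" by blast
    then show "s = s'"
      using free_transversal_uniqueD[OF T] uniq s by cases blast+
  next
    fix x
    obtain y where y: "y \<in> A \<union> T" "(x, y) \<in> R" "(y, x) \<in> R"
      by (rule free_transversal_coverE[OF T])
    obtain z where z: "z \<in> A \<union> T" "(q, z) \<in> R" "(z, q) \<in> R"
      by (rule free_transversal_coverE[OF T])
    show "\<exists>y\<in>A \<union> (T - {t}). (x, y) \<in> merge_rel p q R \<inter> (merge_rel p q R)\<inverse>"
    proof (cases "y = t")
      case True
      have "z \<noteq> t" using trans[OF pt(1), of q] z(3) pq by blast
      moreover have "(x, p) \<in> R" "(p, x) \<in> R"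
        using True y(2,3) pt trans[of x t p] trans[of p t x] by simp_all
      then have "(x, z) \<in> merge_rel p q R \<inter> (merge_rel p q R)\<inverse>"
        using z(2,3) unfolding merge_rel_def add_rel_def by blast
      ultimately show ?thesis using z(1) by blast
    next
      case False
      then show ?thesis using y sub by blast
    qed
  qed
qed

lemma weak_ext_add_rel: "weak_ext (add_rel p q R) A h = {f \<in> weak_ext R A h. f p \<le> f q}"
proof -
  have "f p \<le> f q" if "f \<in> weak_ext (add_rel p q R) A h" for f
    using that marked_preorder_reflD[OF R] by (auto simp: weak_ext_def add_rel_def)
  moreover have "f x \<le> f y" if "f \<in> weak_ext R A h" "f p \<le> f q" "(x, p) \<in> R" "(q, y) \<in> R" for f x y
    using weak_extD[OF that(1,3)] weak_extD[OF that(1,4)] that(2) by linarith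
  ultimately show ?thesis
    unfolding weak_ext_def add_rel_def by blast
qed

end

lemma weak_ext_merge_rel:
  "weak_ext (merge_rel p q R) A h = weak_ext (add_rel p q R) A h \<inter> weak_ext (add_rel q p R) A h"
  by (auto simp: merge_rel_def weak_ext_def)

context
  fixes A :: "'a set" and l R p q
  assumes R: "marked_preorder A l R" and pq: "(p, q) \<notin> R" and qp: "(q, p) \<notin> R"
begin

text \<open>A tie \<open>f p = f q\<close> would require \<open>(q, p)\<close> in the enlarged
  relation. Conversely, \<open>f p < f q\<close> separates all newly related elements, so ties occur
  only along \<open>R\<close>.\<close>

lemma strict_ext_add_rel: "strict_ext (add_rel p q R) A h = {f \<in> strict_ext R A h. f p < f q}"
proof (intro equalityI subsetI)
  note refl = marked_preorder_reflD[OF R] and trans = marked_preorder_transD[OF R]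
  fix f assume f: "f \<in> strict_ext (add_rel p q R) A h"
  then have w: "f \<in> weak_ext R A h" "f p \<le> f q"
    by (simp_all add: strict_ext_def weak_ext_add_rel[OF R pq qp])
  have reverse: "(y, x) \<in> add_rel p q R" if "(x, y) \<in> add_rel p q R" "f x = f y" for x y
    using f that by (auto simp: strict_ext_def)
  have "(p, q) \<in> add_rel p q R" using refl by (auto simp: add_rel_def)
  moreover have "(q, p) \<notin> add_rel p q R" using qp by (auto simp: add_rel_def)
  ultimately have "f p \<noteq> f q" using reverse by blast
  moreover have "(y, x) \<in> R" if "(x, y) \<in> R" "f x = f y" for x y
  proof -
    have "(y, x) \<in> add_rel p q R" using that reverse by (simp add: add_rel_def)
    then show ?thesis using that(1) trans qp unfolding add_rel_def by blast
  qed
  ultimately show "f \<in> {f \<in> strict_ext R A h. f p < f q}"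
    using w by (auto simp: strict_ext_def)
next
  fix f assume "f \<in> {f \<in> strict_ext R A h. f p < f q}"
  then have f: "f \<in> strict_ext R A h" and less: "f p < f q" by auto
  have w: "f \<in> weak_ext R A h" using f by (simp add: strict_ext_def)
  have "f x < f y" if "(x, p) \<in> R" "(q, y) \<in> R" for x y
    using weak_extD[OF w that(1)] weak_extD[OF w that(2)] less by linarith
  then have "(y, x) \<in> add_rel p q R" if "(x, y) \<in> add_rel p q R" "f x = f y" for x y
    using that strict_extD[OF f] less_irrefl unfolding add_rel_def by (metis (no_types, lifting) UnE UnI1 mem_Collect_eq case_prodD)
  then show "f \<in> strict_ext (add_rel p q R) A h"
    using w less by (auto simp: strict_ext_def weak_ext_add_rel[OF R pq qp])
qed

lemma strict_ext_merge_rel: "strict_ext (merge_rel p q R) A h = {f \<in> strict_ext R A h. f p = f q}"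
proof (intro equalityI subsetI)
  note refl = marked_preorder_reflD[OF R] and trans = marked_preorder_transD[OF R]
  fix f assume f: "f \<in> strict_ext (merge_rel p q R) A h"
  then have w: "f \<in> weak_ext R A h" "f p = f q"
    by (simp_all add: strict_ext_def weak_ext_merge_rel weak_ext_add_rel[OF R pq qp] weak_ext_add_rel[OF R qp pq])
  have "(y, x) \<in> R" if "(x, y) \<in> R" "f x = f y" for x y
  proof -
    have "(y, x) \<in> merge_rel p q R"
      using that f by (auto simp: strict_ext_def merge_rel_def add_rel_def)
    then show ?thesis using that(1) trans pq qp unfolding merge_rel_def add_rel_def by blast
  qed
  then show "f \<in> {f \<in> strict_ext R A h. f p = f q}"
    using w by (auto simp: strict_ext_def)
next
  note trans = marked_preorder_transD[OF R]
  fix f assume "f \<in> {f \<in> strict_ext R A h. f p = f q}"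
  then have f: "f \<in> strict_ext R A h" and eq: "f p = f q" by auto
  have w: "f \<in> weak_ext R A h" using f by (simp add: strict_ext_def)
  have mono: "f x \<le> f y" if "(x, y) \<in> R" for x y using w that by (auto simp: weak_ext_def)
  have reverse: "(y, x) \<in> R" if "(x, y) \<in> R" "f x = f y" for x y
    using f that by (auto simp: strict_ext_def)
  \<comment> \<open>A tie across a new pair forces \<open>f x = f p' = f q' = f y\<close>.
    Strictness on \<open>R\<close> reverses both halves of the path, and the opposite new pair joins
    them.\<close>
  have "(y, x) \<in> merge_rel p q R" if "(x, p') \<in> R" "(q', y) \<in> R" "f x = f y"
    "p' = p \<and> q' = q \<or> p' = q \<and> q' = p" for x y p' q'
  proof -
    have "f p' = f q'" using eq that(4) by auto
    then have "f x = f p'" "f q' = f y"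
      using mono[OF that(1)] mono[OF that(2)] that(3) by auto
    then have "(p', x) \<in> R" "(y, q') \<in> R" using reverse that by auto
    then show ?thesis using that(4) unfolding merge_rel_def add_rel_def by blast
  qed
  then have "(y, x) \<in> merge_rel p q R" if "(x, y) \<in> merge_rel p q R" "f x = f y" for x y
    using that reverse unfolding merge_rel_def add_rel_def by blast
  then show "f \<in> strict_ext (merge_rel p q R) A h"
    using w eq by (auto simp: strict_ext_def weak_ext_merge_rel weak_ext_add_rel[OF R pq qp] weak_ext_add_rel[OF R qp pq])
qed

end

section \<open>Splitting the counts, and the induction\<close>

lemma finite_weak_ext:
  fixes R :: "('a::finite \<times> 'a) set"
  assumes "marked_preorder A l R"
  shows "finite (weak_ext R A h)"
proof -
  have "\<forall>x. \<exists>a\<in>A. \<exists>b\<in>A. (a, x) \<in> R \<and> (x, b) \<in> R"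
    using assms by (simp add: marked_preorder_def)
  then obtain a b where ab: "\<And>x. a x \<in> A \<and> b x \<in> A \<and> (a x, x) \<in> R \<and> (x, b x) \<in> R"
    by metis
  have "f x \<in> {h (a x)..h (b x)}" if "f \<in> weak_ext R A h" for f x
    using weak_extD[OF that, of "a x" x] weak_extD[OF that, of x "b x"] ab[of x] that
    by (simp add: weak_ext_def)
  then have "weak_ext R A h \<subseteq> PiE UNIV (\<lambda>x. {h (a x)..h (b x)})"
    by (simp add: PiE_UNIV_domain Pi_def subset_iff)
  then show ?thesis by (rule finite_subset) (intro finite_PiE; simp)
qed

text \<open>Inclusion-exclusion for \<open>f p \<le> f q\<close> and \<open>f q \<le> f p\<close>,
  one of which always holds.\<close>

lemma card_weak_ext_split:
  fixes R :: "('a::finite \<times> 'a) set"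
  assumes R: "marked_preorder A l R" and pq: "(p, q) \<notin> R" "(q, p) \<notin> R"
  shows "card (weak_ext (add_rel p q R) A h) + card (weak_ext (add_rel q p R) A h)
    = card (weak_ext R A h) + card (weak_ext (merge_rel p q R) A h)"
proof -
  have "weak_ext R A h = weak_ext (add_rel p q R) A h \<union> weak_ext (add_rel q p R) A h"
    by (auto simp: weak_ext_add_rel[OF R pq] weak_ext_add_rel[OF R pq(2,1)])
  moreover have "finite (weak_ext (add_rel p q R) A h)" "finite (weak_ext (add_rel q p R) A h)"
    using finite_weak_ext[OF R] by (auto simp: weak_ext_add_rel[OF R pq] weak_ext_add_rel[OF R pq(2,1)])
  ultimately show ?thesis
    by (metis card_Un_Int weak_ext_merge_rel)
qed

text \<open>Trichotomy for \<open>f p\<close> and \<open>f q\<close>; the cases are disjoint, so the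
  third enters with a plus.\<close>

lemma card_strict_ext_split:
  fixes R :: "('a::finite \<times> 'a) set"
  assumes R: "marked_preorder A l R" and pq: "(p, q) \<notin> R" "(q, p) \<notin> R"
  shows "card (strict_ext R A h) = card (strict_ext (add_rel p q R) A h)
    + card (strict_ext (add_rel q p R) A h) + card (strict_ext (merge_rel p q R) A h)"
proof -
  let ?S = "strict_ext R A h"
  have fin: "finite ?S" using finite_weak_ext[OF R, of h] by (simp add: strict_ext_def)
  have "?S = ({f \<in> ?S. f p < f q} \<union> {f \<in> ?S. f q < f p}) \<union> {f \<in> ?S. f p = f q}"
    (is "_ = (?X \<union> ?Y) \<union> ?Z") by auto
  then have "card ?S = card ((?X \<union> ?Y) \<union> ?Z)" by (rule arg_cong)
  moreover have "card ((?X \<union> ?Y) \<union> ?Z) = card (?X \<union> ?Y) + card ?Z"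
    using fin by (intro card_Un_disjoint) auto
  moreover have "card (?X \<union> ?Y) = card ?X + card ?Y"
    using fin by (intro card_Un_disjoint) auto
  ultimately have "card ?S = card ?X + card ?Y + card ?Z" by (simp only:)
  then show ?thesis
    by (simp only: strict_ext_add_rel[OF R pq] strict_ext_add_rel[OF R pq(2,1)] strict_ext_merge_rel[OF R pq])
qed

text \<open>Induction on the number of unrelated ordered pairs, which each of the three enlargements
  lowers.\<close>

theorem reciprocity_marked_preorder:
  fixes R :: "('a::finite \<times> 'a) set"
  assumes "marked_preorder A l R" and "free_transversal A R T"
  shows "\<exists>w. (\<forall>t\<ge>1. real (card (weak_ext R A (\<lambda>a. int t * l a))) = poly w (real t)) \<and>
    poly w (-1) = (-1) ^ card T * real (card (strict_ext R A l))"
  using assms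
proof (induction "card (- R)" arbitrary: R T rule: less_induct)
  case less
  note R = less.prems(1) and T = less.prems(2)
  show ?case
  proof (cases "\<forall>x y. (x, y) \<in> R \<or> (y, x) \<in> R")
    case True
    then show ?thesis using reciprocity_total[OF R _ T] by blast
  next
    case False
    \<comment> \<open>The class of \<open>p\<close> must be unmarked, so that merging loses a
      representative. One of two incomparable elements qualifies, because any two marks are
      comparable.\<close>
    then obtain p q where pq: "(p, q) \<notin> R" "(q, p) \<notin> R" 
      and p: "\<And>a. a \<in> A \<Longrightarrow> (p, a) \<notin> R \<inter> R\<inverse>"
    proof -
      obtain x y where xy: "(x, y) \<notin> R" "(y, x) \<notin> R" using False by blast
      show thesis
      proof (cases "\<exists>a\<in>A. (x, a) \<in> R \<inter> R\<inverse>")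
        case True
        then obtain a where a: "a \<in> A" "(x, a) \<in> R" "(a, x) \<in> R" by blast
        have "(y, b) \<notin> R \<inter> R\<inverse>" if "b \<in> A" for b
        proof
          assume b: "(y, b) \<in> R \<inter> R\<inverse>"
          have "(a, b) \<in> R \<or> (b, a) \<in> R"
            using marked_preorder_marksD[OF R] a(1) that by auto
          then show False using a b xy marked_preorder_transD[OF R] by blast
        qed
        then show ?thesis using that xy by blast
      qed (use that xy in blast)
    qed
    have grow: "card (- R') < card (- R)" if "R \<subseteq> R'" "(x, y) \<in> R'" "(x, y) \<notin> R" for R' x y
      using that by (intro psubset_card_mono) auto
    have gr: "card (- add_rel p q R) < card (- R)" "card (- add_rel q p R) < card (- R)"
      "card (- merge_rel p q R) < card (- R)"
      by (rule grow[of _ p q] grow[of _ q p];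
          use pq marked_preorder_reflD[OF R] in \<open>auto simp: add_rel_def merge_rel_def\<close>)+
    obtain t where t: "t \<in> T" "free_transversal A (merge_rel p q R) (T - {t})"
      using free_transversal_merge_rel[OF R pq T p] by blast
    obtain w1 where w1: "\<And>t. t \<ge> 1 \<Longrightarrow> real (card (weak_ext (add_rel p q R) A (\<lambda>a. int t * l a))) = poly w1 (real t)"
      "poly w1 (-1) = (-1) ^ card T * real (card (strict_ext (add_rel p q R) A l))"
      using less.hyps[OF gr(1) marked_preorder_add_rel[OF R pq] free_transversal_add_rel[OF R pq T]] by blast
    obtain w2 where w2: "\<And>t. t \<ge> 1 \<Longrightarrow> real (card (weak_ext (add_rel q p R) A (\<lambda>a. int t * l a))) = poly w2 (real t)"
      "poly w2 (-1) = (-1) ^ card T * real (card (strict_ext (add_rel q p R) A l))"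
      using less.hyps[OF gr(2) marked_preorder_add_rel[OF R pq(2,1)] free_transversal_add_rel[OF R pq(2,1) T]] by blast
    obtain w3 where w3: "\<And>t. t \<ge> 1 \<Longrightarrow> real (card (weak_ext (merge_rel p q R) A (\<lambda>a. int t * l a))) = poly w3 (real t)"
      "poly w3 (-1) = (-1) ^ card (T - {t}) * real (card (strict_ext (merge_rel p q R) A l))"
      using less.hyps[OF gr(3) marked_preorder_merge_rel[OF R pq] t(2)] by blast
    \<comment> \<open>One unmarked class fewer means the opposite sign, which turns the minus of
      inclusion-exclusion into the plus of the strict split.\<close>
    have "card T = Suc (card (T - {t}))" using t(1) by (metis card_Suc_Diff1 finite)
    then have "poly (w1 + w2 - w3) (-1) = (-1) ^ card T * real (card (strict_ext R A l))"
      using w1(2) w2(2) w3(2) by (simp add: card_strict_ext_split[OF R pq] algebra_simps)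
    moreover have "real (card (weak_ext R A (\<lambda>a. int t * l a))) = poly (w1 + w2 - w3) (real t)"
      if "t \<ge> 1" for t
    proof -
      have "real (card (weak_ext R A (\<lambda>a. int t * l a))) =
        real (card (weak_ext (add_rel p q R) A (\<lambda>a. int t * l a)))
        + real (card (weak_ext (add_rel q p R) A (\<lambda>a. int t * l a)))
        - real (card (weak_ext (merge_rel p q R) A (\<lambda>a. int t * l a)))"
        using card_weak_ext_split[OF R pq, of "\<lambda>a. int t * l a"] by linarith
      then show ?thesis using w1(1) w2(1) w3(1) that by simp
    qed
    ultimately show ?thesis by blast
  qed
qed

section \<open>The preorder of a marked poset\<close>

text \<open>One passage through the marks suffices for order preserving \<open>l\<close>: two
  passages joined by \<open>b \<le> y \<le> c\<close> satisfy \<open>l b \<le> l c\<close> and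
  combine into one.\<close>

definition mark_closure :: "'p::order set \<Rightarrow> ('p \<Rightarrow> int) \<Rightarrow> ('p \<times> 'p) set" where
  "mark_closure A l = {(x, y). x \<le> y \<or> (\<exists>a\<in>A. \<exists>b\<in>A. x \<le> a \<and> l a \<le> l b \<and> b \<le> y)}"

text \<open>For order preserving \<open>l\<close> these are the elements equivalent to no mark in
  the closure; all other coordinates are fixed on the polytope.\<close>

definition free_elems :: "'p::order set \<Rightarrow> ('p \<Rightarrow> int) \<Rightarrow> 'p set" where
  "free_elems A l = {x. \<not> (\<exists>a\<in>A. \<exists>b\<in>A. a \<le> x \<and> x \<le> b \<and> l a = l b)}"

lemma extremal_marks:
  fixes A :: "'p::{finite,order} set"
  assumes "minimal_elems \<union> maximal_elems \<subseteq> A"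
  shows "\<exists>a\<in>A. a \<le> x" "\<exists>b\<in>A. x \<le> b"
proof -
  obtain m where "m \<le> x" and m: "\<And>y. y \<le> m \<Longrightarrow> m = y"
    using finite_has_minimal2[of UNIV x] by auto
  have "\<not> y < m" for y using m[of y] order_less_le by blast
  then have "m \<in> minimal_elems" by (simp add: minimal_elems_def)
  with \<open>m \<le> x\<close> assms show "\<exists>a\<in>A. a \<le> x" by blast
  obtain n where "x \<le> n" and n: "\<And>y. n \<le> y \<Longrightarrow> n = y"
    using finite_has_maximal2[of UNIV x] by auto
  have "\<not> n < y" for y using n[of y] order_less_le by blast
  then have "n \<in> maximal_elems" by (simp add: maximal_elems_def)
  with \<open>x \<le> n\<close> assms show "\<exists>b\<in>A. x \<le> b" by blast
qed

context
  fixes A :: "'p::{finite,order} set" and l :: "'p \<Rightarrow> int"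
  assumes ext: "minimal_elems \<union> maximal_elems \<subseteq> A" and l: "mono_on A l"
begin

lemma marked_preorder_mark_closure: "marked_preorder A l (mark_closure A l)"
  unfolding marked_preorder_def
proof (intro conjI ballI allI)
  have lmono: "l a \<le> l b" if "a \<in> A" "b \<in> A" "a \<le> b" for a b
    using l that by (rule mono_onD)
  show "refl (mark_closure A l)" by (auto simp: refl_on_def mark_closure_def)
  show "trans (mark_closure A l)"
  proof (rule transI)
    fix x y z assume xy: "(x, y) \<in> mark_closure A l" and yz: "(y, z) \<in> mark_closure A l"
    from xy consider "x \<le> y" | a b where "a \<in> A" "b \<in> A" "x \<le> a" "l a \<le> l b" "b \<le> y"
      by (auto simp: mark_closure_def)
    then show "(x, z) \<in> mark_closure A l"
    proof cases
      case 1
      with yz show ?thesis unfolding mark_closure_def by (blast intro: order_trans)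
    next
      case xy: 2
      from yz consider "y \<le> z" | c d where "c \<in> A" "d \<in> A" "y \<le> c" "l c \<le> l d" "d \<le> z"
        by (auto simp: mark_closure_def)
      then show ?thesis
      proof cases
        case 1
        with xy show ?thesis unfolding mark_closure_def by (blast intro: order_trans)
      next
        case 2
        have "l b \<le> l c" using lmono xy(2,5) 2(1,3) by (meson order_trans)
        then have "l a \<le> l d" using xy(4) 2(4) by simp
        then show ?thesis using xy 2 unfolding mark_closure_def by blast
      qed
    qed
  qed
  fix a b assume ab: "a \<in> A" "b \<in> A"
  show "(a, b) \<in> mark_closure A l \<longleftrightarrow> l a \<le> l b"
  proof
    assume "(a, b) \<in> mark_closure A l"
    then show "l a \<le> l b"
      using lmono ab unfolding mark_closure_def by (smt (verit) case_prodD mem_Collect_eq)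
  qed (use ab in \<open>auto simp: mark_closure_def\<close>)
next
  fix x
  show "\<exists>a\<in>A. \<exists>b\<in>A. (a, x) \<in> mark_closure A l \<and> (x, b) \<in> mark_closure A l"
    using extremal_marks[OF ext] unfolding mark_closure_def by blast
qed

text \<open>A cycle through \<open>x\<close> that passes the marks would give
  \<open>b \<le> x \<le> a\<close> with \<open>l a \<le> l b\<close>, hence equal values by
  monotonicity, and \<open>x\<close> would not be free. So the cycle lies in the order of
  \<open>P\<close> and is trivial.\<close>

lemma mark_closure_antisym:
  assumes "(x, y) \<in> mark_closure A l" "(y, x) \<in> mark_closure A l" "x \<in> free_elems A l"
  shows "x = y"
proof (rule ccontr)
  assume "x \<noteq> y"
  have lmono: "l a \<le> l b" if "a \<in> A" "b \<in> A" "a \<le> b" for a b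
    using l that by (rule mono_onD)
  have no: False if "a \<in> A" "b \<in> A" "l a \<le> l b" "b \<le> x" "x \<le> a" for a b
  proof -
    have "l b \<le> l a" using that by (intro lmono) auto
    then show False using assms(3) that by (auto simp: free_elems_def)
  qed
  from assms(1) consider "x \<le> y" | a b where "a \<in> A" "b \<in> A" "x \<le> a" "l a \<le> l b" "b \<le> y"
    by (auto simp: mark_closure_def)
  then show False
  proof cases
    case xy: 1
    with \<open>x \<noteq> y\<close> have "\<not> y \<le> x" by auto
    with assms(2) obtain a b where "a \<in> A" "b \<in> A" "y \<le> a" "l a \<le> l b" "b \<le> x"
      by (auto simp: mark_closure_def)
    then show ?thesis using no xy by (meson order_trans)
  next
    case xy: 2
    from assms(2) consider "y \<le> x" | c d where "c \<in> A" "d \<in> A" "y \<le> c" "l c \<le> l d" "d \<le> x"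
      by (auto simp: mark_closure_def)
    then show ?thesis
    proof cases
      case 1
      then show ?thesis using no xy by (meson order_trans)
    next
      case 2
      have "l b \<le> l c" using lmono xy(2,5) 2(1,3) by (meson order_trans)
      then have "l a \<le> l d" using xy(4) 2(4) by simp
      then show ?thesis using no xy(1,3) 2(2,5) by blast
    qed
  qed
qed

lemma free_transversal_mark_closure: "free_transversal A (mark_closure A l) (free_elems A l)"
  unfolding free_transversal_def
proof (intro conjI ballI allI impI)
  fix t a assume t: "t \<in> free_elems A l" and a: "a \<in> A"
  have "t \<noteq> a" using t a by (auto simp: free_elems_def)
  then show "(t, a) \<notin> mark_closure A l \<inter> (mark_closure A l)\<inverse>"
    using mark_closure_antisym t by blast
next
  fix s t assume "s \<in> free_elems A l" "(s, t) \<in> mark_closure A l \<inter> (mark_closure A l)\<inverse>"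
  then show "s = t" using mark_closure_antisym by blast
next
  fix x
  show "\<exists>y\<in>A \<union> free_elems A l. (x, y) \<in> mark_closure A l \<inter> (mark_closure A l)\<inverse>"
  proof (cases "x \<in> free_elems A l")
    case False
    then obtain a b where "a \<in> A" "b \<in> A" "a \<le> x" "x \<le> b" "l a = l b"
      by (auto simp: free_elems_def)
    then have "(x, a) \<in> mark_closure A l" "(a, x) \<in> mark_closure A l"
      unfolding mark_closure_def by force+
    then show ?thesis using \<open>a \<in> A\<close> by blast
  qed (auto simp: mark_closure_def)
qed

lemma weak_ext_mark_closure:
  "weak_ext (mark_closure A l) A (\<lambda>a. int t * l a) = {f. mono f \<and> (\<forall>a\<in>A. f a = int t * l a)}"
proof (intro equalityI subsetI)
  fix f assume "f \<in> weak_ext (mark_closure A l) A (\<lambda>a. int t * l a)"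
  then show "f \<in> {f. mono f \<and> (\<forall>a\<in>A. f a = int t * l a)}"
    by (auto simp: weak_ext_def mark_closure_def mono_def)
next
  fix f assume "f \<in> {f. mono f \<and> (\<forall>a\<in>A. f a = int t * l a)}"
  then have f: "\<And>x y. x \<le> y \<Longrightarrow> f x \<le> f y" "\<And>a. a \<in> A \<Longrightarrow> f a = int t * l a"
    by (auto simp: mono_def)
  have "f x \<le> f y" if "x \<le> a" "l a \<le> l b" "b \<le> y" "a \<in> A" "b \<in> A" for x y a b
  proof -
    have "f a \<le> f b" using f(2) that by (simp add: mult_left_mono)
    then show ?thesis using f(1)[OF that(1)] f(1)[OF that(3)] by simp
  qed
  then show "f \<in> weak_ext (mark_closure A l) A (\<lambda>a. int t * l a)"
    using f by (auto simp: weak_ext_def mark_closure_def)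
qed

text \<open>For \<open>p < q\<close> the reverse relation demanded by strictness cannot come from
  the order, so it passes through marks, and monotonicity makes their values equal.\<close>

lemma strict_ext_mark_closure: "strict_ext (mark_closure A l) A l = strict_extensions A l"
proof (intro equalityI subsetI)
  fix f assume f: "f \<in> strict_ext (mark_closure A l) A l"
  have w: "f \<in> weak_ext (mark_closure A l) A l" by (rule strict_ext_weak[OF f])
  have "mono f" "\<forall>a\<in>A. f a = l a"
    using w by (auto simp: weak_ext_def mark_closure_def mono_def)
  moreover have "\<exists>a\<in>A. \<exists>b\<in>A. l a = l b \<and> a \<le> p \<and> q \<le> b" if "p < q" "f p = f q" for p q
  proof -
    have "(q, p) \<in> mark_closure A l"
      by (rule strict_extD[OF f]) (use that in \<open>auto simp: mark_closure_def\<close>)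
    moreover have "\<not> q \<le> p" using that(1) by auto
    ultimately obtain b a where ab: "a \<in> A" "b \<in> A" "q \<le> b" "l b \<le> l a" "a \<le> p"
      by (auto simp: mark_closure_def)
    then have "l a \<le> l b" using that by (intro mono_onD[OF l]) auto
    with ab(4) have "l a = l b" by simp
    with ab show ?thesis by blast
  qed
  ultimately show "f \<in> strict_extensions A l" by (auto simp: strict_extensions_def)
next
  fix f assume f: "f \<in> strict_extensions A l"
  then have mono: "\<And>x y. x \<le> y \<Longrightarrow> f x \<le> f y" and fl: "\<And>a. a \<in> A \<Longrightarrow> f a = l a"
    and strict: "\<And>p q. p < q \<Longrightarrow> f p = f q \<Longrightarrow> \<exists>a\<in>A. \<exists>b\<in>A. l a = l b \<and> a \<le> p \<and> q \<le> b"
    by (auto simp: strict_extensions_def mono_def)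
  have "f \<in> weak_ext (mark_closure A l) A (\<lambda>a. int 1 * l a)"
    unfolding weak_ext_mark_closure using mono fl by (simp add: mono_def)
  then have w: "f \<in> weak_ext (mark_closure A l) A l" by simp
  moreover have "(y, x) \<in> mark_closure A l" if xy: "(x, y) \<in> mark_closure A l" and eq: "f x = f y" for x y
  proof -
    from xy consider "x = y" | "x < y" | a b where "a \<in> A" "b \<in> A" "x \<le> a" "l a \<le> l b" "b \<le> y"
      by (auto simp: mark_closure_def order_le_less)
    then show ?thesis
    proof cases
      case 1
      then show ?thesis by (simp add: mark_closure_def)
    next
      case 2
      then show ?thesis using strict[OF 2 eq] unfolding mark_closure_def by force
    next
      case 3
      \<comment> \<open>A tie makes \<open>f\<close> constant along \<open>x \<le> a\<close> and
        along \<open>b \<le> y\<close>. Strictness on these two steps yields marks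
        \<open>a' \<le> x\<close> and \<open>b' \<ge> y\<close> of the same value, hence a passage
        from \<open>y\<close> back to \<open>x\<close>.\<close>
      have e: "f x = f a" "f b = f y"
        using mono[OF 3(3)] mono[OF 3(5)] fl[OF 3(1)] fl[OF 3(2)] 3(4) eq by auto
      obtain a' where a': "a' \<in> A" "a' \<le> x" "l a' = f x"
      proof (cases "x = a")
        case True
        then show ?thesis using that 3(1) fl by auto
      next
        case False
        then have "x < a" using 3(3) by simp
        from strict[OF this e(1)] obtain c d where cd: "c \<in> A" "d \<in> A" "l c = l d" "c \<le> x" "a \<le> d"
          by blast
        then have "l c = f x"
          using mono[of c x] mono[of a d] e(1) fl by fastforce
        then show ?thesis using that cd by blast
      qed
      obtain b' where b': "b' \<in> A" "y \<le> b'" "l b' = f y"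
      proof (cases "b = y")
        case True
        then show ?thesis using that 3(2) fl by auto
      next
        case False
        then have "b < y" using 3(5) by simp
        from strict[OF this e(2)] obtain c d where cd: "c \<in> A" "d \<in> A" "l c = l d" "c \<le> b" "y \<le> d"
          by blast
        then have "l d = f y"
          using mono[of c b] mono[of y d] e(2) fl by fastforce
        then show ?thesis using that cd by blast
      qed
      show ?thesis using a' b' eq unfolding mark_closure_def by auto
    qed
  qed
  ultimately show "f \<in> strict_ext (mark_closure A l) A l"
    by (auto simp: strict_ext_def)
qed

section \<open>Lattice points and dimension of the marked order polytope\<close>

lemma card_weak_ext_mark_closure:
  "card (weak_ext (mark_closure A l) A (\<lambda>a. int t * l a)) = Omega A (real t *\<^sub>R vec_of A l)"
proof -
  let ?v = "\<lambda>f::'p \<Rightarrow> int. (\<chi> p. real_of_int (f p)) :: (real, 'p) vec"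
  have "bij_betw ?v {f. mono f \<and> (\<forall>a\<in>A. f a = int t * l a)}
     (marked_order_polytope A (real t *\<^sub>R vec_of A l) \<inter> int_points)"
  proof (rule bij_betwI[where g = "\<lambda>x p. \<lfloor>x $ p\<rfloor>"])
    show "?v \<in> {f. mono f \<and> (\<forall>a\<in>A. f a = int t * l a)} \<rightarrow>
        marked_order_polytope A (real t *\<^sub>R vec_of A l) \<inter> int_points"
      by (auto simp: marked_order_polytope_def int_points_def vec_of_def mono_def)
    show "(\<lambda>x p. \<lfloor>x $ p\<rfloor>) \<in> marked_order_polytope A (real t *\<^sub>R vec_of A l) \<inter> int_points \<rightarrow>
        {f. mono f \<and> (\<forall>a\<in>A. f a = int t * l a)}"
    proof clarsimp
      fix x assume x: "x \<in> marked_order_polytope A (real t *\<^sub>R vec_of A l)"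
      have "\<lfloor>x $ a\<rfloor> = int t * l a" if "a \<in> A" for a
      proof -
        have "x $ a = real_of_int (int t * l a)"
          using x that by (simp add: marked_order_polytope_def vec_of_def)
        then show ?thesis by (simp only: floor_of_int)
      qed
      then show "mono (\<lambda>p. \<lfloor>x $ p\<rfloor>) \<and> (\<forall>a\<in>A. \<lfloor>x $ a\<rfloor> = int t * l a)"
        using x by (auto simp: marked_order_polytope_def mono_def floor_mono)
    qed
    show "(\<lambda>p. \<lfloor>?v f $ p\<rfloor>) = f" for f by simp
    show "?v (\<lambda>p. \<lfloor>x $ p\<rfloor>) = x" if "x \<in> marked_order_polytope A (real t *\<^sub>R vec_of A l) \<inter> int_points" for x
      using that by (simp add: int_points_def vec_eq_iff)
  qed
  then show ?thesis
    unfolding Omega_def weak_ext_mark_closure by (rule bij_betw_same_card)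
qed

text \<open>A coordinate that is not free is squeezed between equal marks. Each free coordinate can
  be moved alone between two points of the polytope, so the directions span the free coordinate
  subspace.\<close>

lemma aff_dim_marked_order_polytope:
  "aff_dim (marked_order_polytope A (vec_of A l)) = int (card (free_elems A l))"
proof -
  let ?O = "marked_order_polytope A (vec_of A l)" and ?T = "free_elems A l"
  \<comment> \<open>\<open>lo\<close> and \<open>hi\<close> are the least and the greatest extension
    of \<open>l\<close>; they differ precisely at the free elements.\<close>
  define lo where "lo x = Max (l ` {a \<in> A. a \<le> x})" for x
  define hi where "hi x = Min (l ` {b \<in> A. x \<le> b})" for x
  have lmono: "l a \<le> l b" if "a \<in> A" "b \<in> A" "a \<le> b" for a b
    using l that by (rule mono_onD)
  have lo_in: "\<exists>a\<in>A. a \<le> x \<and> lo x = l a" for x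
  proof -
    have "lo x \<in> l ` {a \<in> A. a \<le> x}"
      unfolding lo_def using extremal_marks(1)[OF ext, of x] by (intro Max_in) auto
    then show ?thesis by auto
  qed
  have hi_in: "\<exists>b\<in>A. x \<le> b \<and> hi x = l b" for x
  proof -
    have "hi x \<in> l ` {b \<in> A. x \<le> b}"
      unfolding hi_def using extremal_marks(2)[OF ext, of x] by (intro Min_in) auto
    then show ?thesis by auto
  qed
  have lo_ge: "l a \<le> lo x" if "a \<in> A" "a \<le> x" for a x
    unfolding lo_def using that by (intro Max_ge) auto
  have hi_le: "hi x \<le> l b" if "b \<in> A" "x \<le> b" for b x
    unfolding hi_def using that by (intro Min_le) auto
  have lo_mono: "lo x \<le> lo y" if "x \<le> y" for x y
    using lo_in[of x] lo_ge[of _ y] that by (metis order_trans)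
  have hi_mono: "hi x \<le> hi y" if "x \<le> y" for x y
    using hi_in[of y] hi_le[of _ x] that by (metis order_trans)
  have lo_hi: "lo x \<le> hi x" for x
    using lo_in[of x] hi_in[of x] lmono by (metis order_trans)
  have lo_hi_free: "lo x < hi x" if "x \<in> ?T" for x
  proof -
    obtain a b where "a \<in> A" "a \<le> x" "lo x = l a" "b \<in> A" "x \<le> b" "hi x = l b"
      using lo_in[of x] hi_in[of x] by blast
    then have "lo x \<noteq> hi x" using that by (auto simp: free_elems_def)
    then show ?thesis using lo_hi[of x] by simp
  qed
  have mark: "lo a = l a" "hi a = l a" if "a \<in> A" for a
    using lo_ge[OF that, of a] hi_le[OF that, of a] lo_hi[of a] by auto
  \<comment> \<open>For up-sets \<open>U\<close> these are points of the polytope; passing from \<open>{t<..}\<close> to \<open>{t..}\<close> moves only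
    the coordinate \<open>t\<close>, so every free coordinate direction occurs.\<close>
  define \<psi> :: "'p set \<Rightarrow> (real, 'p) vec" where
    "\<psi> U = (\<chi> x. real_of_int (if x \<in> U then hi x else lo x))" for U
  have \<psi>: "\<psi> U \<in> ?O" if "\<And>x y. x \<in> U \<Longrightarrow> x \<le> y \<Longrightarrow> y \<in> U" for U
  proof -
    have "(if x \<in> U then hi x else lo x) \<le> (if y \<in> U then hi y else lo y)" if "x \<le> y" for x y
      using that \<open>\<And>x y. x \<in> U \<Longrightarrow> x \<le> y \<Longrightarrow> y \<in> U\<close>[of x y] lo_mono[OF that] hi_mono[OF that] lo_hi[of y] by auto
    then show ?thesis
      unfolding marked_order_polytope_def \<psi>_def by (simp add: mono_def vec_of_def mark)
  qed
  have agree: "\<phi> $ x = \<phi>' $ x" if "\<phi> \<in> ?O" "\<phi>' \<in> ?O" "x \<notin> ?T" for \<phi> \<phi>' x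
  proof -
    obtain a b where ab: "a \<in> A" "b \<in> A" "a \<le> x" "x \<le> b" "l a = l b"
      using \<open>x \<notin> ?T\<close> by (auto simp: free_elems_def)
    have "\<xi> $ x = real_of_int (l a)" if "\<xi> \<in> ?O" for \<xi> :: "(real, 'p) vec"
    proof -
      have "mono (($) \<xi>)" "\<xi> $ a = real_of_int (l a)" "\<xi> $ b = real_of_int (l b)"
        using that ab(1,2) by (simp_all add: marked_order_polytope_def vec_of_def)
      moreover from this(1) have "\<xi> $ a \<le> \<xi> $ x" "\<xi> $ x \<le> \<xi> $ b"
        using ab(3,4) by (simp_all add: monoD)
      ultimately have "real_of_int (l a) \<le> \<xi> $ x" "\<xi> $ x \<le> real_of_int (l b)" by simp_all
      then show ?thesis using ab(5) by simp
    qed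
    then show ?thesis using that(1,2) by simp
  qed
  have z: "\<psi> {} \<in> ?O" by (rule \<psi>) simp
  let ?D = "(\<lambda>x. x - \<psi> {}) ` ?O"
  have "span ?D = coord_space ?T"
  proof
    have "subspace (coord_space ?T)"
      by (auto simp: subspace_def coord_space_def)
    moreover have "?D \<subseteq> coord_space ?T"
      using agree[OF _ z] by (auto simp: coord_space_def)
    ultimately show "span ?D \<subseteq> coord_space ?T" by (simp add: span_minimal)
    show "coord_space ?T \<subseteq> span ?D"
    proof
      fix x assume x: "x \<in> coord_space ?T"
      have ax: "axis t 1 \<in> span ?D" if "t \<in> ?T" for t
      proof -
        have "\<psi> {t..} \<in> ?O" "\<psi> {t<..} \<in> ?O" by (rule \<psi>; auto)+
        then have "(\<psi> {t..} - \<psi> {}) - (\<psi> {t<..} - \<psi> {}) \<in> span ?D"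
          by (intro span_diff span_base) auto
        also have "(\<psi> {t..} - \<psi> {}) - (\<psi> {t<..} - \<psi> {}) = real_of_int (hi t - lo t) *\<^sub>R axis t 1"
          by (auto simp: vec_eq_iff \<psi>_def axis_def order_le_less)
        finally have "(1 / real_of_int (hi t - lo t)) *\<^sub>R (real_of_int (hi t - lo t) *\<^sub>R axis t 1) \<in> span ?D"
          by (rule span_scale)
        then show ?thesis using lo_hi_free[OF that] by simp
      qed
      have "x = (\<Sum>t\<in>?T. x $ t *\<^sub>R axis t 1)"
        using x by (auto simp: vec_eq_iff coord_space_def axis_def if_distrib cong: if_cong)
      also have "\<dots> \<in> span ?D"
        by (intro span_sum span_scale ax)
      finally show "x \<in> span ?D" .
    qed
  qed
  moreover have "dim (coord_space ?T) = card ?T"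
    using dim_substandard_cart[of ?T, where 'a = real] by (simp add: coord_space_def dim_vec_eq)
  ultimately have "dim ?D = card ?T" by (metis dim_span)
  then show ?thesis
    using aff_dim_eq_dim_subtract[OF hull_inc[OF z]] by simp
qed

end

section \<open>Polynomials on the line through the marking\<close>

lemma chain_cone_scale:
  assumes "x \<in> chain_cone A k I" "0 \<le> c"
  shows "c *\<^sub>R x \<in> chain_cone A k I"
  using assms by (auto simp: chain_cone_def coord_space_def constant_on_def mult_left_mono; metis)

lemma real_polynomial_function_on_line:
  fixes v :: "'a::euclidean_space"
  assumes "real_polynomial_function f"
  obtains u where "\<And>t. f (t *\<^sub>R v) = poly u t"
proof -
  have "polynomial_function (\<lambda>t::real. t *\<^sub>R v)"
    by (intro polynomial_function_bounded_linear bounded_linear_scaleR_left)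
  then have "real_polynomial_function (f \<circ> (\<lambda>t. t *\<^sub>R v))"
    using assms by (rule real_polynomial_function_compose)
  then obtain a n where "f \<circ> (\<lambda>t. t *\<^sub>R v) = (\<lambda>t. \<Sum>i\<le>n. a i * t ^ i)"
    by (auto simp: real_polynomial_function_iff_sum)
  then have "f (t *\<^sub>R v) = poly (\<Sum>i\<le>n. monom (a i) i) t" for t
    by (simp add: fun_eq_iff poly_sum poly_monom)
  then show thesis using that by blast
qed

lemma poly_eq_of_nat:
  fixes p q :: "real poly"
  assumes "\<And>t::nat. t \<ge> 1 \<Longrightarrow> poly p (real t) = poly q (real t)"
  shows "p = q"
proof (rule ccontr)
  assume "p \<noteq> q"
  then have "finite {x. poly (p - q) x = 0}" by (intro poly_roots_finite) simp
  moreover have "real ` {1..} \<subseteq> {x. poly (p - q) x = 0}" using assms by auto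
  ultimately have "finite (real ` {1..})" by (rule finite_subset[rotated])
  then show False using infinite_Ici[of "1::nat"] by (simp add: finite_image_iff)
qed

theorem theorem2p13:
  fixes A :: "'p::{finite,order} set"
    and l :: "'p \<Rightarrow> int"
    and k :: nat
    and I :: "nat \<Rightarrow> 'p set"
    and poly_I :: "(real, 'p) vec \<Rightarrow> real"
  assumes "minimal_elems \<union> maximal_elems \<subseteq> A"
    and "mono_on A l"
    and "ideal_chain A k I"
    and "vec_of A l \<in> rel_interior (chain_cone A k I)"
    and "real_polynomial_function poly_I"
    and "\<forall>\<mu> \<in> chain_cone A k I \<inter> int_points. real (Omega A \<mu>) = poly_I \<mu>"
  shows "(-1) powi aff_dim (marked_order_polytope A (vec_of A l)) * poly_I (- vec_of A l)
         = real (card (strict_extensions A l))"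
proof -
  note ext = assms(1) and l = assms(2)
  let ?R = "mark_closure A l" and ?d = "card (free_elems A l)"
  obtain w where w: "\<And>t. t \<ge> 1 \<Longrightarrow> real (card (weak_ext ?R A (\<lambda>a. int t * l a))) = poly w (real t)"
    "poly w (-1) = (-1) ^ ?d * real (card (strict_ext ?R A l))"
    using reciprocity_marked_preorder[OF marked_preorder_mark_closure[OF ext l]
        free_transversal_mark_closure[OF ext l]] by blast
  obtain u where u: "\<And>t. poly_I (t *\<^sub>R vec_of A l) = poly u t"
    using real_polynomial_function_on_line[OF assms(5)] by blast
  have "vec_of A l \<in> chain_cone A k I"
    using assms(4) rel_interior_subset by blast
  \<comment> \<open>The cone contains the whole ray through \<open>\<lambda>\<close>, so
    \<open>poly_I\<close> counts extensions at every multiple \<open>t * \<lambda>\<close>.\<close>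
  then have "real t *\<^sub>R vec_of A l \<in> chain_cone A k I \<inter> int_points" for t
    by (simp add: chain_cone_scale) (simp add: int_points_def vec_of_def)
  then have "poly w (real t) = poly u (real t)" if "t \<ge> 1" for t
    using that w(1)[of t] assms(6) by (simp add: card_weak_ext_mark_closure[OF ext l] u)
  \<comment> \<open>Agreement at all positive integers identifies the polynomials, and this carries
    the identity over to \<open>t = -1\<close>.\<close>
  then have "w = u" by (rule poly_eq_of_nat)
  then have "poly_I (- vec_of A l) = (-1) ^ ?d * real (card (strict_extensions A l))"
    using u[of "-1"] w(2) by (simp add: strict_ext_mark_closure[OF ext l])
  \<comment> \<open>The dimension is the cardinality \<open>?d\<close>, so \<open>powi\<close> is an
    ordinary power and the two signs cancel.\<close>
  then show ?thesis
    by (simp add: aff_dim_marked_order_polytope[OF ext l] power_int_def power_mult_distrib[symmetric])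
qed

end
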